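(* Let $R$ be a commutative ring and $\mathcal A$ a commutative $R$-algebra such that the abelian group $(\mathcal A,+)$ is torsion-free. Then for every $R$-derivation $D$ of $\mathcal A$ which is locally integral over $R$, the image $\operatorname{Im}D:=D(\mathcal A)$ satisfies $\operatorname{Im}D\subseteq\operatorname{nil}(\mathcal A)$, where $\operatorname{nil}(\mathcal A)$ is the set of nilpotent elements of $\mathcal A$.
   Context: Rings $R$ are unital. An $R$-derivation of $\mathcal A$ is an $R$-linear map $D$ with $D(ab)=D(a)b+aD(b)$. $D$ is locally integral over $R$ if for each $a\in\mathcal A$ there exist a $D$-invariant $R$-subalgebra $\mathcal A_1$ of $\mathcal A$ containing $a$ and a monic polynomial $p_a(t)\in R[t]$ such that $p_a(D)|_{\mathcal A_1}=0$. *)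

theory Defs
  imports "HOL-Algebra.Module" "HOL-Algebra.Subrings" "HOL-Algebra.UnivPoly"
begin

text \<open>
  Algebras are instances of the locale \<open>algebra R A\<close>, which makes both \<open>R\<close> and \<open>A\<close>
  commutative unital rings (the zero ring is allowed).
  Maps on an algebra are HOL functions of which only the values on the carrier matter.
\<close>

definition derivation ::
  "('r, 'm) ring_scheme \<Rightarrow> ('r, 'a, 'n) module_scheme \<Rightarrow> ('a \<Rightarrow> 'a) \<Rightarrow> bool" where
  "derivation R A D \<longleftrightarrow>
     D \<in> carrier A \<rightarrow> carrier A \<and>
     (\<forall>a\<in>carrier A. \<forall>b\<in>carrier A. D (a \<oplus>\<^bsub>A\<^esub> b) = D a \<oplus>\<^bsub>A\<^esub> D b) \<and>
     (\<forall>r\<in>carrier R. \<forall>a\<in>carrier A. D (r \<odot>\<^bsub>A\<^esub> a) = r \<odot>\<^bsub>A\<^esub> D a) \<and>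
     (\<forall>a\<in>carrier A. \<forall>b\<in>carrier A.
        D (a \<otimes>\<^bsub>A\<^esub> b) = (D a \<otimes>\<^bsub>A\<^esub> b) \<oplus>\<^bsub>A\<^esub> (a \<otimes>\<^bsub>A\<^esub> D b))"

text \<open>
  The locale \<open>subring\<close> requires the unit of \<open>A\<close> to lie in \<open>B\<close>.
\<close>

definition unital_subalgebra ::
  "('r, 'm) ring_scheme \<Rightarrow> ('r, 'a, 'n) module_scheme \<Rightarrow> 'a set \<Rightarrow> bool" where
  "unital_subalgebra R A B \<longleftrightarrow> subring B A \<and> submodule B R A"

definition monic_UP :: "('r, 'm) ring_scheme \<Rightarrow> (nat \<Rightarrow> 'r) \<Rightarrow> bool" where
  "monic_UP R p \<longleftrightarrow> p \<in> carrier (UP R) \<and> coeff (UP R) p (deg R p) = \<one>\<^bsub>R\<^esub>"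

text \<open>
  The value at \<open>x\<close> of the operator \<open>p(D)\<close>, for a polynomial \<open>p\<close> over \<open>R\<close>.
\<close>

definition poly_operator ::
  "('r, 'm) ring_scheme \<Rightarrow> ('r, 'a, 'n) module_scheme \<Rightarrow> (nat \<Rightarrow> 'r) \<Rightarrow> ('a \<Rightarrow> 'a) \<Rightarrow> 'a \<Rightarrow> 'a" where
  "poly_operator R A p D x =
     (\<Oplus>\<^bsub>A\<^esub>i\<in>{..deg R p}. coeff (UP R) p i \<odot>\<^bsub>A\<^esub> (D ^^ i) x)"

definition locally_integral ::
  "('r, 'm) ring_scheme \<Rightarrow> ('r, 'a, 'n) module_scheme \<Rightarrow> ('a \<Rightarrow> 'a) \<Rightarrow> bool" where
  "locally_integral R A D \<longleftrightarrow>
     (\<forall>a\<in>carrier A. \<exists>A1 p.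
        unital_subalgebra R A A1 \<and> D ` A1 \<subseteq> A1 \<and> a \<in> A1 \<and>
        monic_UP R p \<and> (\<forall>x\<in>A1. poly_operator R A p D x = \<zero>\<^bsub>A\<^esub>))"

definition additively_torsion_free :: "('a, 'm) ring_scheme \<Rightarrow> bool" where
  "additively_torsion_free A \<longleftrightarrow>
     (\<forall>a\<in>carrier A. \<forall>n::nat. n > 0 \<and> [n] \<cdot>\<^bsub>A\<^esub> a = \<zero>\<^bsub>A\<^esub> \<longrightarrow> a = \<zero>\<^bsub>A\<^esub>)"

definition nilpotents :: "('a, 'm) ring_scheme \<Rightarrow> 'a set" where
  "nilpotents A = {a \<in> carrier A. \<exists>n::nat. n > 0 \<and> a [^]\<^bsub>A\<^esub> n = \<zero>\<^bsub>A\<^esub>}"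

end

theory Submission
  imports Defs
begin

text \<open>
  Let \<open>p\<close> be monic of degree \<open>d\<close> with \<open>p(D) = 0\<close> on an invariant subalgebra containing \<open>x\<close>, and
  take the commutator of the differential operator \<open>p(D)\<close> with multiplication by \<open>x\<close>, \<open>d\<close> times
  over. Every commutator lowers the order by one, so that only the principal symbol
  \<open>d! (D x)\<^sup>d\<close> is left; on the other hand the result vanishes, as \<open>p(D)\<close> does. Since \<open>A\<close> is
  torsion-free, \<open>(D x)\<^sup>d = 0\<close>.
\<close>

text \<open>Up to sign, \<open>ad\<close> of the multiplication by \<open>x\<close>. It acts on bare
  HOL functions, so \<open>^^\<close> iterates it directly and identities are stated at points of
  the carrier.\<close>

definition mult_commutator :: "('a, 'm) ring_scheme \<Rightarrow> 'a \<Rightarrow> ('a \<Rightarrow> 'a) \<Rightarrow> 'a \<Rightarrow> 'a" where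
  "mult_commutator A x F = (\<lambda>y. F (x \<otimes>\<^bsub>A\<^esub> y) \<ominus>\<^bsub>A\<^esub> x \<otimes>\<^bsub>A\<^esub> F y)"

locale cring_derivation = cring A for A (structure) +
  fixes D :: "'a \<Rightarrow> 'a"
  assumes D_closed [simp, intro]: "a \<in> carrier A \<Longrightarrow> D a \<in> carrier A"
    and D_add: "\<lbrakk>a \<in> carrier A; b \<in> carrier A\<rbrakk> \<Longrightarrow> D (a \<oplus> b) = D a \<oplus> D b"
    and D_mult: "\<lbrakk>a \<in> carrier A; b \<in> carrier A\<rbrakk> \<Longrightarrow> D (a \<otimes> b) = D a \<otimes> b \<oplus> a \<otimes> D b"
begin

lemma D_zero [simp]: "D \<zero> = \<zero>"
  using D_add[of \<zero> \<zero>] by (simp add: add.l_cancel_one')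

lemma D_minus:
  assumes "a \<in> carrier A" "b \<in> carrier A"
  shows "D (a \<ominus> b) = D a \<ominus> D b"
proof -
  have "D a = D ((a \<ominus> b) \<oplus> b)" using assms by (simp add: a_minus_def a_assoc l_neg)
  also have "\<dots> = D (a \<ominus> b) \<oplus> D b" using assms by (simp add: D_add)
  finally show ?thesis using assms by (simp add: a_minus_def a_assoc r_neg)
qed

lemma D_funpow_closed: "a \<in> carrier A \<Longrightarrow> (D ^^ i) a \<in> carrier A"
  by (induction i) auto

lemma mult_commutator_funpow_closed:
  assumes "x \<in> carrier A" "\<And>y. y \<in> carrier A \<Longrightarrow> G y \<in> carrier A" "y \<in> carrier A"
  shows "(mult_commutator A x ^^ n) G y \<in> carrier A"
  using assms(3) by (induction n arbitrary: y) (auto simp: mult_commutator_def assms)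

text \<open>The commutator with \<open>x\<close> is a derivation for composition. It sends
  \<open>D\<close> to multiplication by \<open>D x\<close>, which commutes with multiplication by
  \<open>x\<close>, so a second commutator kills it. Of the higher Leibniz rule for
  \<open>D \<circ> G\<close> only two terms survive. The exponent \<open>Suc n\<close> avoids a
  truncated \<open>n - 1\<close>.\<close>

lemma mult_commutator_funpow_D_comp:
  assumes x: "x \<in> carrier A" and G: "\<And>y. y \<in> carrier A \<Longrightarrow> G y \<in> carrier A"
    and y: "y \<in> carrier A"
  shows "(mult_commutator A x ^^ Suc n) (D \<circ> G) y
    = D ((mult_commutator A x ^^ Suc n) G y)
      \<oplus> [Suc n] \<cdot> (D x \<otimes> (mult_commutator A x ^^ n) G y)"
  using y
proof (induction n arbitrary: y)
  case 0
  have alg: "u \<ominus> x \<otimes> v = (u \<ominus> (w \<oplus> x \<otimes> v)) \<oplus> w"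
    if "u \<in> carrier A" "v \<in> carrier A" "w \<in> carrier A" for u v w
    using x that by algebra
  show ?case
    using 0 x G alg[of "D (G (x \<otimes> y))" "D (G y)" "D x \<otimes> G y"]
    by (simp add: mult_commutator_def D_minus D_mult)
next
  case (Suc n)
  define V where "V \<equiv> (mult_commutator A x ^^ n) G"
  define W where "W \<equiv> (mult_commutator A x ^^ Suc n) G"
  have Vc: "V z \<in> carrier A" and Wc: "W z \<in> carrier A" if "z \<in> carrier A" for z
    unfolding V_def W_def using mult_commutator_funpow_closed[of x G z] x G that by blast+
  have W: "W z = V (x \<otimes> z) \<ominus> x \<otimes> V z" for z
    by (simp add: W_def V_def mult_commutator_def)
  have alg: "(dW \<oplus> [Suc n] \<cdot> (dx \<otimes> a)) \<ominus> x \<otimes> (dw \<oplus> [Suc n] \<cdot> (dx \<otimes> b))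
      = (dW \<ominus> (dx \<otimes> (a \<ominus> x \<otimes> b) \<oplus> x \<otimes> dw)) \<oplus> [Suc (Suc n)] \<cdot> (dx \<otimes> (a \<ominus> x \<otimes> b))"
    if c: "dW \<in> carrier A" "dw \<in> carrier A" "dx \<in> carrier A" "a \<in> carrier A" "b \<in> carrier A"
    for dW dw dx a b
  proof -
    \<comment> \<open>Natural multiples are turned into products with the ring element
      \<open>k\<close>, which makes the claim a polynomial identity within reach of
      \<open>algebra\<close>.\<close>
    define k where "k = [Suc n] \<cdot> \<one>"
    have k: "k \<in> carrier A" by (simp add: k_def)
    have sc: "[Suc n] \<cdot> z = k \<otimes> z" "[Suc (Suc n)] \<cdot> z = k \<otimes> z \<oplus> z" if "z \<in> carrier A" for z
      using that add_pow_ldistr[of \<one> z "Suc n"] by (simp_all add: k_def)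
    show ?thesis using c x k by (simp only: sc m_closed minus_closed) algebra
  qed
  have "(mult_commutator A x ^^ Suc (Suc n)) (D \<circ> G) y
      = (mult_commutator A x ^^ Suc n) (D \<circ> G) (x \<otimes> y)
        \<ominus> x \<otimes> (mult_commutator A x ^^ Suc n) (D \<circ> G) y"
    by (simp add: mult_commutator_def)
  also have "\<dots> = (D (W (x \<otimes> y)) \<oplus> [Suc n] \<cdot> (D x \<otimes> V (x \<otimes> y)))
      \<ominus> x \<otimes> (D (W y) \<oplus> [Suc n] \<cdot> (D x \<otimes> V y))"
    using Suc.IH[of y] Suc.IH[of "x \<otimes> y"] Suc.prems x unfolding V_def W_def by (simp only: m_closed)
  also have "\<dots> = (D (W (x \<otimes> y)) \<ominus> (D x \<otimes> W y \<oplus> x \<otimes> D (W y))) \<oplus> [Suc (Suc n)] \<cdot> (D x \<otimes> W y)"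
    using alg[of "D (W (x \<otimes> y))" "D (W y)" "D x" "V (x \<otimes> y)" "V y"] Suc.prems x Vc Wc
    by (simp flip: W del: add.nat_pow_Suc)
  \<comment> \<open>By the Leibniz rule the bracket is \<open>D (x \<otimes> W y)\<close>. The term
    \<open>D x \<otimes> W y\<close> split off for this is what raises the multiple from
    \<open>Suc n\<close> to \<open>Suc (Suc n)\<close>.\<close>
  also have "D (W (x \<otimes> y)) \<ominus> (D x \<otimes> W y \<oplus> x \<otimes> D (W y)) = D (W (x \<otimes> y) \<ominus> x \<otimes> W y)"
    using Suc.prems x Wc by (simp add: D_minus D_mult)
  also have "W (x \<otimes> y) \<ominus> x \<otimes> W y = (mult_commutator A x ^^ Suc (Suc n)) G y"
    by (simp add: W_def mult_commutator_def)
  finally show ?case unfolding W_def .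
qed

text \<open>\<open>D ^^ i\<close> is a differential operator of order at most \<open>i\<close>, so
  more than \<open>i\<close> commutators annihilate it. The base case is that the identity commutes
  with multiplication by \<open>x\<close>.\<close>

lemma mult_commutator_funpow_D_lower:
  assumes "x \<in> carrier A" "y \<in> carrier A" "i < n"
  shows "(mult_commutator A x ^^ n) (D ^^ i) y = \<zero>"
  using assms(2,3)
proof (induction i arbitrary: n y)
  case 0
  have "(mult_commutator A x ^^ Suc m) (\<lambda>y. y) y = \<zero>" if "y \<in> carrier A" for m y
    using that assms(1)
    by (induction m arbitrary: y) (simp_all add: mult_commutator_def a_minus_def r_neg)
  with 0 show ?case by (cases n) (simp_all add: id_def)
next
  case (Suc i)
  \<comment> \<open>Since \<open>i < m\<close>, the induction hypothesis applies to both exponents,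
    \<open>Suc m\<close> and \<open>m\<close>, that occur in the formula for
    \<open>D \<circ> D ^^ i\<close>.\<close>
  then obtain m where "n = Suc m" "i < m" by (cases n) auto
  with Suc show ?case
    using mult_commutator_funpow_D_comp[of x "D ^^ i" y m] assms(1) D_funpow_closed
    by (simp only: funpow.simps(2)[of i D] less_Suc_eq simp_thms) simp
qed

text \<open>This is the principal symbol. In the formula for \<open>D \<circ> D ^^ n\<close> the
  first term vanishes, as \<open>n + 1\<close> commutators exceed the order \<open>n\<close>. The
  second contributes the factor \<open>Suc n\<close> of the factorial and one more
  \<open>D x\<close>.\<close>

lemma mult_commutator_funpow_D:
  assumes "x \<in> carrier A" "y \<in> carrier A"
  shows "(mult_commutator A x ^^ n) (D ^^ n) y = [(fact n :: nat)] \<cdot> (D x [^] n \<otimes> y)"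
proof (induction n)
  case 0
  show ?case using assms by simp
next
  case (Suc n)
  have "(mult_commutator A x ^^ Suc n) (D ^^ Suc n) y
      = [Suc n] \<cdot> (D x \<otimes> [(fact n :: nat)] \<cdot> (D x [^] n \<otimes> y))"
    using mult_commutator_funpow_D_comp[of x "D ^^ n" y n] assms D_funpow_closed Suc
      mult_commutator_funpow_D_lower[of x y n "Suc n"]
    by (simp only: funpow.simps(2)[of n D] lessI) (simp del: add.nat_pow_Suc)
  also have "\<dots> = [(fact (Suc n) :: nat)] \<cdot> (D x \<otimes> (D x [^] n \<otimes> y))"
    using assms by (simp add: add_pow_rdistr add.nat_pow_pow mult.commute del: add.nat_pow_Suc)
  also have "D x \<otimes> (D x [^] n \<otimes> y) = D x [^] Suc n \<otimes> y"
    using assms by (simp add: m_ac)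
  finally show ?case .
qed

end

text \<open>The operator \<open>p(D)\<close> is known to vanish only on a subalgebra. Its iterated
  commutators at a point of \<open>B\<close> evaluate it only at multiples of that point by powers
  of \<open>x\<close>, which stay in \<open>B\<close>.\<close>

lemma mult_commutator_funpow_vanish:
  assumes "cring A" "x \<in> B" "B \<subseteq> carrier A"
    and "\<And>y. y \<in> B \<Longrightarrow> x \<otimes>\<^bsub>A\<^esub> y \<in> B" "\<And>y. y \<in> B \<Longrightarrow> F y = \<zero>\<^bsub>A\<^esub>"
    and "y \<in> B"
  shows "(mult_commutator A x ^^ n) F y = \<zero>\<^bsub>A\<^esub>"
proof -
  interpret cring A by fact
  show ?thesis
    using assms(6)
  proof (induction n arbitrary: y)
    case (Suc n)
    then show ?case using assms(2-4) by (auto simp: mult_commutator_def)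
  qed (use assms in simp)
qed

text \<open>Forming the commutator is \<open>R\<close>-linear in the operator, because scalars
  commute with multiplication by \<open>x\<close>. It may therefore be applied to
  \<open>p(D)\<close> term by term.\<close>

lemma mult_commutator_funpow_poly_operator:
  assumes "algebra R A" "cring_derivation A D" "p \<in> carrier (UP R)"
    and x: "x \<in> carrier A" and y: "y \<in> carrier A"
  shows "(mult_commutator A x ^^ n) (poly_operator R A p D) y
    = (\<Oplus>\<^bsub>A\<^esub>i\<in>{..deg R p}. coeff (UP R) p i \<odot>\<^bsub>A\<^esub> (mult_commutator A x ^^ n) (D ^^ i) y)"
  using y
proof (induction n arbitrary: y)
  case 0
  show ?case by (simp add: poly_operator_def)
next
  case (Suc n)
  interpret A: cring A using assms(1) by (rule algebra.axioms)
  interpret algebra R A by fact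
  interpret d: cring_derivation A D by fact
  interpret UP: UP_cring R "UP R" by unfold_locales simp_all
  define c where "c = coeff (UP R) p"
  have c: "c i \<in> carrier R" for i unfolding c_def using assms(3) by simp
  define E where "E i = (mult_commutator A x ^^ n) (D ^^ i)" for i
  have E: "E i z \<in> carrier A" if "z \<in> carrier A" for i z
    unfolding E_def using d.mult_commutator_funpow_closed[of x "D ^^ i" z] x that
      d.D_funpow_closed by blast
  \<comment> \<open>The subtraction is written as a sum with the factor \<open>\<ominus> x\<close>
    so that additivity and distributivity of finite sums apply.\<close>
  have "c i \<odot>\<^bsub>A\<^esub> (E i (x \<otimes>\<^bsub>A\<^esub> y) \<ominus>\<^bsub>A\<^esub> x \<otimes>\<^bsub>A\<^esub> E i y)
      = c i \<odot>\<^bsub>A\<^esub> E i (x \<otimes>\<^bsub>A\<^esub> y) \<oplus>\<^bsub>A\<^esub> (\<ominus>\<^bsub>A\<^esub> x) \<otimes>\<^bsub>A\<^esub> (c i \<odot>\<^bsub>A\<^esub> E i y)" for i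
  proof -
    have "x \<otimes>\<^bsub>A\<^esub> (c i \<odot>\<^bsub>A\<^esub> E i y) = c i \<odot>\<^bsub>A\<^esub> (x \<otimes>\<^bsub>A\<^esub> E i y)"
      using c E x Suc.prems by (metis smult_assoc2 A.m_comm smult_closed)
    then show ?thesis using c E x Suc.prems
      by (simp add: a_minus_def smult_r_distr smult_r_minus A.l_minus)
  qed
  moreover have "(\<Oplus>\<^bsub>A\<^esub>i\<in>{..deg R p}. (\<ominus>\<^bsub>A\<^esub> x) \<otimes>\<^bsub>A\<^esub> (c i \<odot>\<^bsub>A\<^esub> E i y))
      = \<ominus>\<^bsub>A\<^esub> (x \<otimes>\<^bsub>A\<^esub> (\<Oplus>\<^bsub>A\<^esub>i\<in>{..deg R p}. c i \<odot>\<^bsub>A\<^esub> E i y))"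
    using c E x Suc.prems
    by (subst A.finsum_rdistr[symmetric]) (auto simp: A.l_minus A.finsum_closed)
  ultimately have "(\<Oplus>\<^bsub>A\<^esub>i\<in>{..deg R p}. c i \<odot>\<^bsub>A\<^esub> (E i (x \<otimes>\<^bsub>A\<^esub> y) \<ominus>\<^bsub>A\<^esub> x \<otimes>\<^bsub>A\<^esub> E i y))
      = (\<Oplus>\<^bsub>A\<^esub>i\<in>{..deg R p}. c i \<odot>\<^bsub>A\<^esub> E i (x \<otimes>\<^bsub>A\<^esub> y))
        \<ominus>\<^bsub>A\<^esub> x \<otimes>\<^bsub>A\<^esub> (\<Oplus>\<^bsub>A\<^esub>i\<in>{..deg R p}. c i \<odot>\<^bsub>A\<^esub> E i y)"
    using c E x Suc.prems by (simp add: a_minus_def A.finsum_addf)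
  moreover have "(mult_commutator A x ^^ Suc n) (D ^^ i) y = E i (x \<otimes>\<^bsub>A\<^esub> y) \<ominus>\<^bsub>A\<^esub> x \<otimes>\<^bsub>A\<^esub> E i y" for i
    by (simp add: mult_commutator_def E_def)
  moreover have "(mult_commutator A x ^^ Suc n) F y = (mult_commutator A x ^^ n) F (x \<otimes>\<^bsub>A\<^esub> y)
      \<ominus>\<^bsub>A\<^esub> x \<otimes>\<^bsub>A\<^esub> (mult_commutator A x ^^ n) F y" for F
    by (simp add: mult_commutator_def)
  ultimately show ?case
    using Suc.IH Suc.prems x by (simp only: A.m_closed c_def E_def)
qed

theorem theorem4p3:
  fixes R :: "('r, 'm) ring_scheme"
    and A :: "('r, 'a, 'n) module_scheme"
    and D :: "'a \<Rightarrow> 'a"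
  assumes "algebra R A"
    and "additively_torsion_free A"
    and "derivation R A D"
    and "locally_integral R A D"
  shows "D ` carrier A \<subseteq> nilpotents A"
proof clarify
  fix x assume x: "x \<in> carrier A"
  interpret A: cring A using assms(1) by (rule algebra.axioms)
  interpret algebra R A by fact
  interpret d: cring_derivation A D
    using assms(3) by unfold_locales (auto simp: derivation_def)
  obtain B p where B: "unital_subalgebra R A B" "x \<in> B" and p: "monic_UP R p"
    and pB: "\<And>y. y \<in> B \<Longrightarrow> poly_operator R A p D y = \<zero>\<^bsub>A\<^esub>"
    using assms(4) x unfolding locally_integral_def by metis
  interpret B: subring B A using B by (simp add: unital_subalgebra_def)
  define n where "n = deg R p"
  define E where "E i = (mult_commutator A x ^^ n) (D ^^ i) \<one>\<^bsub>A\<^esub>" for i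
  \<comment> \<open>Evaluation at the unit, which lies in \<open>B\<close> because the subalgebra is
    unital, later turns multiplication by \<open>D x [^] n\<close> into that element itself.\<close>
  have "\<zero>\<^bsub>A\<^esub> = (mult_commutator A x ^^ n) (poly_operator R A p D) \<one>\<^bsub>A\<^esub>"
    by (rule mult_commutator_funpow_vanish[where B = B, symmetric])
      (use B pB B.subset A.is_cring in auto)
  also have "\<dots> = (\<Oplus>\<^bsub>A\<^esub>i\<in>{..n}. coeff (UP R) p i \<odot>\<^bsub>A\<^esub> E i)"
    using mult_commutator_funpow_poly_operator[OF assms(1) d.cring_derivation_axioms] p x
    by (simp add: monic_UP_def n_def E_def)
  \<comment> \<open>Terms with \<open>i < n\<close> have too low an order to survive
    \<open>n\<close> commutators. At \<open>i = n\<close> the coefficient is one, as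
    \<open>p\<close> is monic.\<close>
  also have "\<dots> = (\<Oplus>\<^bsub>A\<^esub>i\<in>{..n}. if n = i then E n else \<zero>\<^bsub>A\<^esub>)"
  proof (rule A.finsum_cong')
    interpret UP: UP_cring R "UP R" by unfold_locales simp_all
    have En: "E n \<in> carrier A" 
      unfolding E_def using d.mult_commutator_funpow_D[of x "\<one>\<^bsub>A\<^esub>" n] x by simp
    then show "(\<lambda>i. if n = i then E n else \<zero>\<^bsub>A\<^esub>) \<in> {..n} \<rightarrow> carrier A" by auto
    fix i assume "i \<in> {..n}"
    moreover have "E i = \<zero>\<^bsub>A\<^esub>" if "i < n"
      unfolding E_def using d.mult_commutator_funpow_D_lower x that by simp
    ultimately show "coeff (UP R) p i \<odot>\<^bsub>A\<^esub> E i = (if n = i then E n else \<zero>\<^bsub>A\<^esub>)"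
      using p En by (auto simp: monic_UP_def n_def le_less)
  qed simp
  also have "\<dots> = E n"
    using d.mult_commutator_funpow_D[of x "\<one>\<^bsub>A\<^esub>" n] x
    by (intro A.finsum_singleton) (auto simp: E_def)
  also have "\<dots> = [(fact n :: nat)] \<cdot>\<^bsub>A\<^esub> (D x [^]\<^bsub>A\<^esub> n)"
    using d.mult_commutator_funpow_D[of x "\<one>\<^bsub>A\<^esub>" n] x by (simp add: E_def)
  \<comment> \<open>Torsion-freeness cancels the positive integer \<open>fact n\<close>.\<close>
  finally have "D x [^]\<^bsub>A\<^esub> n = \<zero>\<^bsub>A\<^esub>"
    using assms(2) x unfolding additively_torsion_free_def
    by (metis A.nat_pow_closed d.D_closed fact_gt_zero)
  \<comment> \<open>The exponent is raised by one since \<open>n = 0\<close> is possible, when \<open>A\<close> is the zero ring.\<close>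
  then have "D x [^]\<^bsub>A\<^esub> Suc n = \<zero>\<^bsub>A\<^esub>" using x by simp
  then show "D x \<in> nilpotents A"
    using x unfolding nilpotents_def by blast
qed

end
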